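(* Let $d \geq 2$ be an integer, let $\sigma$ be a symmetric finite positive Borel measure on $\mathbb{S}^{d-1}$ such that $\inf_{e\in\mathbb{S}^{d-1}}\int_{\mathbb{S}^{d-1}}|\langle e;y\rangle|^2\sigma(dy)>0$, and let $\mathbf{\Sigma}$ be the symmetric positive definite $d\times d$ matrix with entries $\sigma_{\ell,k}=\int_{\mathbb{S}^{d-1}}y_\ell y_k\sigma(dy)$. Let $D_\sigma$ be the anisotropic local gradient operator $D_\sigma(f)(x)=\int_{\mathbb{S}^{d-1}}y\langle y;\nabla(f)(x)\rangle\sigma(dy)$. Let $p \in (1,d)$ and let $q = pd/(d-p)$. Then there exists a constant $C_{\sigma,d,p}>0$, depending only on $d$, $\sigma$ and $p$, such that, for all $f \in \mathcal{C}^{\infty}_c(\mathbb{R}^d)$, $$\|f\|_{L^q(\mathbb{R}^d,dx)} \leq C_{\sigma,d,p}\, \| \mathbf{\Sigma}^{-\frac{1}{2}} D_\sigma(f)\|_{L^p(\mathbb{R}^d,dx)}.$$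
   Context: $\langle\cdot;\cdot\rangle$ is the Euclidean inner product on $\mathbb{R}^d$ and $\mathbb{S}^{d-1}$ the Euclidean unit sphere; $\sigma$ symmetric means $\sigma(B)=\sigma(-B)$ for all Borel $B\subset\mathbb{S}^{d-1}$. The $L^p$ norm of an $\mathbb{R}^d$-valued function is the $L^p$ norm of its Euclidean norm. *)

theory Defs
  imports "HOL-Analysis.Analysis"
begin

text \<open>The gradient as the vector of partial derivatives; total, but only meaningful where
  \<open>f\<close> is differentiable.\<close>

definition gradient :: "(real ^ 'n \<Rightarrow> real) \<Rightarrow> real ^ 'n \<Rightarrow> real ^ 'n" where
  "gradient f x = (\<chi> i. frechet_derivative f (at x) (axis i 1))"

text \<open>\<open>Ck k f\<close> says that \<open>f\<close> is \<open>k\<close> times continuously differentiable on the whole space.\<close>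

fun Ck :: "nat \<Rightarrow> (real ^ 'n \<Rightarrow> real) \<Rightarrow> bool" where
  "Ck 0 f \<longleftrightarrow> continuous_on UNIV f"
| "Ck (Suc k) f \<longleftrightarrow> (\<forall>x. f differentiable (at x)) \<and> (\<forall>i. Ck k (\<lambda>x. gradient f x $ i))"

definition smooth_compact_support :: "(real ^ 'n \<Rightarrow> real) set" where
  "smooth_compact_support = {f. (\<forall>k. Ck k f) \<and> compact (closure {x. f x \<noteq> 0})}"

text \<open>Extended-valued, so that a function outside \<open>L\<^sup>p\<close> has norm \<open>\<infinity>\<close> rather than a junk value.\<close>

definition Lp_norm :: "real \<Rightarrow> (real ^ 'n \<Rightarrow> 'b :: real_normed_vector) \<Rightarrow> ennreal" where
  "Lp_norm p f =
     (let I = (\<integral>\<^sup>+x. ennreal (norm (f x) powr p) \<partial>lborel)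
      in if I = \<infinity> then \<infinity> else ennreal (enn2real I powr (1 / p)))"

text \<open>The measure lives on the sphere itself: its space is \<open>sphere 0 1\<close>.\<close>

definition symmetric_sphere_measure :: "(real ^ 'n) measure \<Rightarrow> bool" where
  "symmetric_sphere_measure \<sigma> \<longleftrightarrow>
     sets \<sigma> = sets (restrict_space borel (sphere 0 1)) \<and>
     finite_measure \<sigma> \<and>
     (\<forall>B \<in> sets \<sigma>. emeasure \<sigma> B = emeasure \<sigma> (uminus ` B))"

definition Sigma_matrix :: "(real ^ 'n) measure \<Rightarrow> real ^ 'n ^ 'n" where
  "Sigma_matrix \<sigma> = (\<chi> l k. LINT y|\<sigma>. y $ l * y $ k)"

definition aniso_gradient ::
    "(real ^ 'n) measure \<Rightarrow> (real ^ 'n \<Rightarrow> real) \<Rightarrow> real ^ 'n \<Rightarrow> real ^ 'n" where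
  "aniso_gradient \<sigma> f x = (LINT y|\<sigma>. (y \<bullet> gradient f x) *\<^sub>R y)"

definition sym_pos_def :: "real ^ 'n ^ 'n \<Rightarrow> bool" where
  "sym_pos_def A \<longleftrightarrow> transpose A = A \<and> (\<forall>x. x \<noteq> 0 \<longrightarrow> x \<bullet> (A *v x) > 0)"

text \<open>For symmetric positive definite \<open>A\<close>, the power \<open>A\<^sup>-\<^sup>1\<^sup>/\<^sup>2\<close>, i.e. the unique symmetric
  positive definite square root of \<open>A\<^sup>-\<^sup>1\<close>; unspecified for other \<open>A\<close>.\<close>

definition matrix_inv_sqrt :: "real ^ 'n ^ 'n \<Rightarrow> real ^ 'n ^ 'n" where
  "matrix_inv_sqrt A = (THE B. sym_pos_def B \<and> B ** B = matrix_inv A)"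

end

theory Submission
  imports Defs
begin

text \<open>Since \<open>D\<^sub>\<sigma> f = \<Sigma> \<nabla>f\<close> pointwise and \<open>\<Sigma>\<close> is positive definite, \<open>\<Sigma>\<^sup>-\<^sup>1\<^sup>/\<^sup>2 \<Sigma>\<close> is an injective
  linear map, hence \<open>c \<bar>\<nabla>f\<bar> \<le> \<bar>\<Sigma>\<^sup>-\<^sup>1\<^sup>/\<^sup>2 D\<^sub>\<sigma> f\<bar>\<close> for some \<open>c > 0\<close>, and the claim reduces to the classical
  Sobolev inequality. The latter follows Gagliardo and Nirenberg: \<open>\<bar>f\<bar>\<^sup>\<gamma>\<close> is bounded by the integral of
  \<open>\<gamma> \<bar>f\<bar>\<^sup>\<gamma>\<^sup>-\<^sup>1 \<bar>\<nabla>f\<bar>\<close> over every line parallel to a coordinate axis, a Loomis--Whitney inequality turns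
  the product of these bounds into the case of exponent one, and Hoelder with a suitable \<open>\<gamma>\<close> gives
  the exponent \<open>p\<close>.\<close>

section \<open>Square roots of positive definite matrices\<close>

text \<open>A maximiser \<open>e\<close> of the Rayleigh quotient on the unit sphere of
  \<open>S\<close> is an eigenvector: the form of \<open>h = M - f\<close> is nonnegative on
  \<open>S\<close> and vanishes at \<open>e\<close>, and a null vector of a nonnegative symmetric
  form lies in its kernel.\<close>

lemma symmetric_linear_eigenvector_exists:
  fixes f :: "'a::euclidean_space \<Rightarrow> 'a"
  assumes lin: "linear f" and sym: "\<And>x y. f x \<bullet> y = x \<bullet> f y"
    and S: "subspace S" "f ` S \<subseteq> S" "\<not> S \<subseteq> {0}"
  obtains e l where "e \<in> S" "norm e = 1" "f e = l *\<^sub>R e"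
proof -
  interpret linear f by fact
  have "compact (sphere 0 1 \<inter> S)"
    by (intro compact_Int_closed closed_subspace S) auto
  moreover obtain z where z: "z \<in> S" "z \<noteq> 0" using S by auto
  then have "(1 / norm z) *\<^sub>R z \<in> sphere 0 1 \<inter> S"
    using S by (auto intro: subspace_scale)
  then have "sphere 0 1 \<inter> S \<noteq> {}" by blast
  moreover have "continuous_on (sphere 0 1 \<inter> S) (\<lambda>x. f x \<bullet> x)"
    by (intro continuous_intros linear_continuous_on linear_conv_bounded_linear[THEN iffD1] lin)
  ultimately obtain e where e: "e \<in> S" "norm e = 1"
    and max: "\<And>x. x \<in> S \<Longrightarrow> norm x = 1 \<Longrightarrow> f x \<bullet> x \<le> f e \<bullet> e"
    using continuous_attains_sup[of "sphere 0 1 \<inter> S" "\<lambda>x. f x \<bullet> x"]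
    by (metis IntD1 IntD2 IntI mem_sphere_0)
  define M where "M = f e \<bullet> e"
  define h where "h x = M *\<^sub>R x - f x" for x
  have h_lin: "h (x + t *\<^sub>R y) = h x + t *\<^sub>R h y" for x y t
    by (simp add: h_def add scale algebra_simps)
  have h_sym: "h x \<bullet> y = x \<bullet> h y" for x y
    by (simp add: h_def inner_diff_left inner_diff_right sym)
  have h_nonneg: "h x \<bullet> x \<ge> 0" if "x \<in> S" for x
  proof (cases "x = 0")
    case False
    have "f ((1 / norm x) *\<^sub>R x) \<bullet> ((1 / norm x) *\<^sub>R x) \<le> M"
      unfolding M_def using False that S by (intro max subspace_scale) auto
    then have "f x \<bullet> x \<le> M * (norm x * norm x)"
      using False by (simp add: scale divide_simps)
    then show ?thesis
      by (simp add: h_def inner_diff_left flip: power2_norm_eq_inner power2_eq_square)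
  qed auto
  have h_S: "h e \<in> S"
    unfolding h_def using S e by (intro subspace_diff subspace_scale) auto
  have he: "h e \<bullet> e = 0"
    using e by (simp add: h_def M_def inner_diff_left flip: power2_norm_eq_inner)
  have "h e \<bullet> h e = 0"
  proof (rule ccontr)
    assume *: "h e \<bullet> h e \<noteq> 0"
    define a where "a = h e \<bullet> h e"
    define b where "b = h (h e) \<bullet> h e"
    have a: "a > 0" using * by (simp add: a_def)
    have b: "b \<ge> 0" unfolding b_def using h_S by (rule h_nonneg)
    have quad: "0 \<le> 2 * t * a + t\<^sup>2 * b" for t
    proof -
      have "0 \<le> h (e + t *\<^sub>R h e) \<bullet> (e + t *\<^sub>R h e)"
        using h_S e S by (intro h_nonneg subspace_add subspace_scale)
      also have "\<dots> = 2 * t * a + t\<^sup>2 * b"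
        by (simp add: h_lin inner_add_left inner_add_right he a_def b_def h_sym[of "h e" e]
            power2_eq_square distrib_left)
      finally show ?thesis .
    qed
    \<comment> \<open>The minimiser of \<open>quad\<close> would be \<open>- a / b\<close>, but
      \<open>b\<close> may be 0; with \<open>b + 1\<close> the denominator is positive and the value
      is still negative.\<close>
    define t where "t = - a / (b + 1)"
    have "2 * t * a + t\<^sup>2 * b = - (a\<^sup>2 * (b + 2)) / (b + 1)\<^sup>2"
      using b by (simp add: t_def power2_eq_square divide_simps) (simp add: algebra_simps)
    also have "\<dots> < 0"
      using a b by (simp add: divide_simps)
    finally show False using quad[of t] by simp
  qed
  then have "f e = M *\<^sub>R e" by (simp add: h_def)
  with e show ?thesis by (rule that)
qed

text \<open>Orthonormal families of eigenvectors are independent, so one of largest size exists. By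
  symmetry its orthogonal complement is invariant under \<open>f\<close>; were it nonzero, it would
  contain a further unit eigenvector.\<close>

lemma symmetric_linear_eigenbasis:
  fixes f :: "'a::euclidean_space \<Rightarrow> 'a"
  assumes lin: "linear f" and sym: "\<And>x y. f x \<bullet> y = x \<bullet> f y"
  obtains E l where "finite E" "pairwise orthogonal E" "\<And>e. e \<in> E \<Longrightarrow> norm e = 1"
    "span E = UNIV" "\<And>e. e \<in> E \<Longrightarrow> f e = l e *\<^sub>R e"
proof -
  interpret linear f by fact
  define good where "good E \<longleftrightarrow> pairwise orthogonal E \<and> (\<forall>e\<in>E. norm e = 1 \<and> (\<exists>l. f e = l *\<^sub>R e))" for E
  have indep: "finite E \<and> card E \<le> DIM('a)" if "good E" for E
  proof -
    have "independent E"
      using that by (intro pairwise_orthogonal_independent) (auto simp: good_def)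
    then show ?thesis using independent_bound by blast
  qed
  have "good {}" by (simp add: good_def)
  then obtain E where E: "good E" and max: "\<And>E'. good E' \<Longrightarrow> card E' \<le> card E"
    using indep ex_has_greatest_nat[of good "{}" card "Suc DIM('a)"] by (metis le_imp_less_Suc)
  have fin: "finite E" using indep E by blast
  define S where "S = {x. \<forall>e\<in>E. orthogonal e x}"
  have S: "subspace S" unfolding S_def
    by (auto simp: subspace_def orthogonal_def inner_add_right)
  have "S \<subseteq> {0}"
  proof (rule ccontr)
    assume "\<not> S \<subseteq> {0}"
    moreover have "f ` S \<subseteq> S"
    proof clarify
      fix x assume x: "x \<in> S"
      have "e \<bullet> f x = 0" if e: "e \<in> E" for e
      proof -
        have "\<exists>l. f e = l *\<^sub>R e" using E e by (simp add: good_def)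
        then show ?thesis using x e sym[of e x] by (auto simp: S_def orthogonal_def)
      qed
      then show "f x \<in> S" by (simp add: S_def orthogonal_def)
    qed
    ultimately obtain e l where e: "e \<in> S" "norm e = 1" "f e = l *\<^sub>R e"
      using symmetric_linear_eigenvector_exists[OF lin sym S] by blast
    then have "e \<notin> E" by (auto simp: S_def orthogonal_def)
    moreover have "good (insert e E)"
      using E e by (auto simp: good_def S_def pairwise_insert orthogonal_commute)
    ultimately show False using max[of "insert e E"] fin by simp
  qed
  have "span E = UNIV"
  proof (rule ccontr)
    assume "span E \<noteq> UNIV"
    then obtain x where "x \<noteq> 0" "\<And>y. y \<in> span E \<Longrightarrow> orthogonal x y"
      using orthogonal_to_subspace_exists_gen[of E UNIV] by auto
    then have "x \<in> S"
      by (auto simp: S_def orthogonal_commute[of _ x] intro: span_base)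
    then show False using \<open>S \<subseteq> {0}\<close> \<open>x \<noteq> 0\<close> by blast
  qed
  moreover obtain l where "\<And>e. e \<in> E \<Longrightarrow> f e = l e *\<^sub>R e"
    using E unfolding good_def by metis
  ultimately show ?thesis using E fin by (intro that[of E l]) (auto simp: good_def)
qed

lemma matrix_vector_inner_symmetric:
  fixes A :: "real ^ 'n ^ 'n"
  assumes "transpose A = A"
  shows "(A *v x) \<bullet> y = x \<bullet> (A *v y)"
  by (metis assms dot_lmul_matrix vector_transpose_matrix)

lemma transpose_eqI_inner:
  fixes A :: "real ^ 'n ^ 'n"
  assumes "\<And>x y. (A *v x) \<bullet> y = x \<bullet> (A *v y)"
  shows "transpose A = A"
proof -
  have "(transpose A *v x - A *v x) \<bullet> y = 0" for x y
    using assms[of x y] by (simp add: inner_diff_left dot_lmul_matrix)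
  then have "transpose A *v x = A *v x" for x
    by (metis eq_iff_diff_eq_0 inner_eq_zero_iff)
  then show ?thesis by (simp add: matrix_eq)
qed

lemma sym_pos_def_eq_0_iff: "sym_pos_def A \<Longrightarrow> A *v x = 0 \<longleftrightarrow> x = 0"
  by (force simp: sym_pos_def_def)

lemma sym_pos_def_invertible:
  assumes "sym_pos_def A"
  shows "invertible A"
proof -
  have "inj ((*v) A)"
    using sym_pos_def_eq_0_iff[OF assms] linear_injective_0[of "(*v) A"]
    by (simp add: matrix_vector_mul_linear)
  then show ?thesis
    by (metis invertible_left_inverse matrix_left_invertible_injective)
qed

lemma matrix_inv_works:
  assumes "invertible A"
  shows "A ** matrix_inv A = mat 1" "matrix_inv A ** A = mat 1"
  using someI_ex[OF assms[unfolded invertible_def]] by (simp_all add: matrix_inv_def)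

text \<open>The difference of two roots is symmetric, hence has an eigenbasis, and positivity of
  both roots forces each eigenvalue to be 0. This gives the uniqueness behind the \<open>THE\<close>
  in \<open>matrix_inv_sqrt\<close>.\<close>

lemma sym_pos_def_sqrt_unique:
  fixes B C :: "real ^ 'n ^ 'n"
  assumes B: "sym_pos_def B" and C: "sym_pos_def C" and eq: "B ** B = C ** C"
  shows "B = C"
proof -
  define f where "f = (\<lambda>x. B *v x - C *v x)"
  have lin: "linear f" unfolding f_def
    by (intro linear_compose_sub matrix_vector_mul_linear)
  have symB: "(B *v x) \<bullet> y = x \<bullet> (B *v y)" and symC: "(C *v x) \<bullet> y = x \<bullet> (C *v y)" for x y
    using B C by (auto simp: sym_pos_def_def intro: matrix_vector_inner_symmetric)
  have sym: "f x \<bullet> y = x \<bullet> f y" for x y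
    by (simp add: f_def inner_diff_left inner_diff_right symB symC)
  obtain E l where E: "finite E" "pairwise orthogonal E" "\<And>e. e \<in> E \<Longrightarrow> norm e = 1"
    "span E = UNIV" "\<And>e. e \<in> E \<Longrightarrow> f e = l e *\<^sub>R e"
    using symmetric_linear_eigenbasis[OF lin sym] by blast
  have BBCC: "B *v (B *v x) = C *v (C *v x)" for x
    by (simp add: matrix_vector_mul_assoc eq)
  have "f e = 0" if "e \<in> E" for e
  proof -
    \<comment> \<open>With \<open>D = B - C\<close> one has \<open>B D + D C = 0\<close>; test this against an eigenvector of \<open>D\<close>.\<close>
    have "B *v f e + f (C *v e) = 0"
      by (simp add: f_def BBCC matrix_vector_mult_diff_distrib)
    then have "0 = e \<bullet> (B *v f e) + f e \<bullet> (C *v e)"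
      unfolding sym by (metis inner_add_right inner_zero_right)
    also have "\<dots> = l e * (e \<bullet> (B *v e) + e \<bullet> (C *v e))"
      by (simp add: E(5)[OF that] matrix_vector_mult_scaleR distrib_left)
    finally have "l e * (e \<bullet> (B *v e) + e \<bullet> (C *v e)) = 0" by simp
    moreover have "e \<noteq> 0" using E(3) that by force
    then have "e \<bullet> (B *v e) + e \<bullet> (C *v e) > 0"
      using B C by (simp add: sym_pos_def_def add_pos_pos)
    ultimately show ?thesis using E(5) that by simp
  qed
  then have "f x = 0" for x
    using linear_eq_0_on_span[OF lin, of E x] E(4) by auto
  then show ?thesis by (simp add: matrix_eq f_def)
qed

text \<open>In an orthonormal eigenbasis of \<open>A\<close>, the map \<open>g\<close> multiplies
  \<open>e\<close> by \<open>1 / sqrt (l e)\<close>. Then \<open>g\<close> applied twice is a left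
  inverse of \<open>A\<close>, which determines the inverse matrix.\<close>

lemma sym_pos_def_inverse_sqrt_exists:
  fixes A :: "real ^ 'n ^ 'n"
  assumes A: "sym_pos_def A"
  obtains B where "sym_pos_def B" "B ** B = matrix_inv A"
proof -
  have symA: "(A *v x) \<bullet> y = x \<bullet> (A *v y)" for x y
    using A by (auto simp: sym_pos_def_def intro: matrix_vector_inner_symmetric)
  obtain E l where E: "finite E" "pairwise orthogonal E" "\<And>e. e \<in> E \<Longrightarrow> norm e = 1"
    "span E = UNIV" and l: "\<And>e. e \<in> E \<Longrightarrow> A *v e = l e *\<^sub>R e"
    using symmetric_linear_eigenbasis[OF matrix_vector_mul_linear symA] by blast
  have l_pos: "l e > 0" if "e \<in> E" for e
  proof -
    have "e \<noteq> 0" using E(3) that by force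
    then have "e \<bullet> (A *v e) > 0" using A by (simp add: sym_pos_def_def)
    moreover have "e \<bullet> e = 1" using E(3) that by (simp add: norm_eq_1)
    ultimately show ?thesis using l that by simp
  qed
  define g where "g x = (\<Sum>e\<in>E. (x \<bullet> e / sqrt (l e)) *\<^sub>R e)" for x
  have g_lin: "linear g"
    by (auto simp: g_def linear_iff inner_add_left add_divide_distrib scaleR_left_distrib
        sum.distrib scaleR_sum_right)
  have inner_E: "e \<bullet> e' = (if e = e' then 1 else 0)" if "e \<in> E" "e' \<in> E" for e e'
    using E that by (auto simp: pairwise_def orthogonal_def norm_eq_1)
  have expand: "(\<Sum>e\<in>E. (x \<bullet> e) *\<^sub>R e) = x" for x
    using E by (intro orthonormal_basis_expand) auto
  have g_inner: "g x \<bullet> e = x \<bullet> e / sqrt (l e)" if "e \<in> E" for x e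
  proof -
    have "g x \<bullet> e = (\<Sum>e'\<in>E. if e' = e then x \<bullet> e / sqrt (l e) else 0)"
      unfolding g_def inner_sum_left by (intro sum.cong) (auto simp: inner_E that)
    then show ?thesis using E that by simp
  qed
  have gg: "g (g (A *v x)) = x" for x
  proof -
    have "g (g (A *v x)) = (\<Sum>e\<in>E. (x \<bullet> e) *\<^sub>R e)"
    proof (subst g_def, intro sum.cong refl)
      fix e assume e: "e \<in> E"
      have "l e * (x \<bullet> e) / (sqrt (l e) * sqrt (l e)) = x \<bullet> e"
        using l_pos[OF e] by simp
      then show "(g (A *v x) \<bullet> e / sqrt (l e)) *\<^sub>R e = (x \<bullet> e) *\<^sub>R e"
        using e by (simp add: g_inner symA l)
    qed
    then show ?thesis by (simp add: expand)
  qed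
  have g_form: "x \<bullet> g y = (\<Sum>e\<in>E. (x \<bullet> e) * (y \<bullet> e) / sqrt (l e))" for x y
    by (simp add: g_def inner_sum_right mult.commute)
  define B where "B = matrix g"
  have B: "B *v x = g x" for x by (simp add: B_def g_lin)
  have "sym_pos_def B"
    unfolding sym_pos_def_def
  proof (intro conjI allI impI)
    show "transpose B = B"
      by (intro transpose_eqI_inner) (subst inner_commute, simp add: B g_form mult.commute)
    fix x :: "real ^ 'n" assume "x \<noteq> 0"
    then obtain e where e: "e \<in> E" "x \<bullet> e \<noteq> 0"
      using expand[of x] by (metis (no_types, lifting) scaleR_zero_left sum.neutral)
    have "0 < (\<Sum>e\<in>E. (x \<bullet> e) * (x \<bullet> e) / sqrt (l e))"
    proof (rule sum_pos2[OF E(1) e(1)])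
      show "0 < x \<bullet> e * (x \<bullet> e) / sqrt (l e)"
        using e l_pos[OF e(1)] by (auto simp: zero_less_mult_iff linorder_neq_iff)
    qed (use l_pos in \<open>auto simp: less_imp_le\<close>)
    then show "0 < x \<bullet> (B *v x)" by (simp add: B g_form)
  qed
  moreover have "(B ** B) ** A = mat 1"
    by (simp add: matrix_eq B gg flip: matrix_vector_mul_assoc)
  then have "B ** B = matrix_inv A"
    by (metis A matrix_inv_works(1) matrix_mul_assoc matrix_mul_lid matrix_mul_rid sym_pos_def_invertible)
  ultimately show ?thesis by (rule that)
qed

lemma sym_pos_def_matrix_inv_sqrt:
  assumes "sym_pos_def A"
  shows "sym_pos_def (matrix_inv_sqrt A)"
proof -
  obtain B where "sym_pos_def B \<and> B ** B = matrix_inv A"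
    using sym_pos_def_inverse_sqrt_exists[OF assms] by blast
  then have "\<exists>!B. sym_pos_def B \<and> B ** B = matrix_inv A"
    using sym_pos_def_sqrt_unique by metis
  from theI'[OF this] show ?thesis
    unfolding matrix_inv_sqrt_def by blast
qed

section \<open>The anisotropic gradient\<close>

text \<open>The space of \<open>\<sigma>\<close> is the compact sphere, on which a continuous
  function is bounded, and \<open>\<sigma>\<close> is finite.\<close>

lemma symmetric_sphere_measure_integrable:
  fixes \<sigma> :: "(real ^ 'n) measure" and g :: "real ^ 'n \<Rightarrow> 'b::{banach, second_countable_topology}"
  assumes \<sigma>: "symmetric_sphere_measure \<sigma>" and g: "continuous_on UNIV g"
  shows "integrable \<sigma> g"
proof -
  have sets: "sets \<sigma> = sets (restrict_space borel (sphere 0 1))" and "finite_measure \<sigma>"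
    using \<sigma> by (auto simp: symmetric_sphere_measure_def)
  then interpret finite_measure \<sigma> by simp
  have space: "space \<sigma> = sphere 0 1"
    using sets_eq_imp_space_eq[OF sets] by (simp add: space_restrict_space)
  have "g \<in> borel_measurable (restrict_space borel (sphere 0 1))"
    using g by (intro measurable_restrict_space1 borel_measurable_continuous_onI)
  then have [measurable]: "g \<in> borel_measurable \<sigma>"
    by (simp add: measurable_cong_sets[OF sets refl])
  have "compact (g ` sphere 0 1)"
    using g by (intro compact_continuous_image) (auto intro: continuous_on_subset)
  then obtain K where "\<And>y. y \<in> sphere 0 1 \<Longrightarrow> norm (g y) \<le> K"
    by (meson bounded_iff compact_imp_bounded imageI)
  then show ?thesis
    by (intro integrable_const_bound[of _ K]) (auto simp: space)
qed

text \<open>With \<open>v = gradient f x\<close> the right-hand side is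
  \<open>aniso_gradient \<sigma> f x\<close>, so the anisotropic gradient becomes a matrix applied
  to the gradient.\<close>

lemma Sigma_matrix_mult_vec:
  fixes \<sigma> :: "(real ^ 'n) measure"
  assumes "symmetric_sphere_measure \<sigma>"
  shows "Sigma_matrix \<sigma> *v v = (LINT y|\<sigma>. (y \<bullet> v) *\<^sub>R y)"
proof -
  have int: "integrable \<sigma> (\<lambda>y. y $ k * y $ j * v $ j)" for k j
    by (intro symmetric_sphere_measure_integrable[OF assms] continuous_intros)
  have int': "integrable \<sigma> (\<lambda>y. (y \<bullet> v) *\<^sub>R y)"
    by (intro symmetric_sphere_measure_integrable[OF assms] continuous_intros)
  have "(Sigma_matrix \<sigma> *v v) $ k = (LINT y|\<sigma>. (y \<bullet> v) *\<^sub>R y) $ k" for k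
  proof -
    have "(Sigma_matrix \<sigma> *v v) $ k = (\<Sum>j\<in>UNIV. LINT y|\<sigma>. y $ k * y $ j * v $ j)"
      by (simp add: matrix_vector_mult_def Sigma_matrix_def)
    also have "\<dots> = (LINT y|\<sigma>. ((y \<bullet> v) *\<^sub>R y) $ k)"
      by (subst Bochner_Integration.integral_sum[symmetric, OF int])
        (simp add: inner_vec_def sum_distrib_left sum_distrib_right mult_ac)
    also have "\<dots> = (LINT y|\<sigma>. (y \<bullet> v) *\<^sub>R y) $ k"
      using integral_inner_left[of "axis k 1", OF int'] by (simp add: inner_axis)
    finally show ?thesis .
  qed
  then show ?thesis by (simp add: vec_eq_iff)
qed

text \<open>The quadratic form of the matrix at \<open>x\<close> is the integral of
  \<open>\<bar>x \<bullet> y\<bar>\<^sup>2\<close>; it is homogeneous of degree 2, so positivity on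
  unit vectors suffices.\<close>

lemma sym_pos_def_Sigma_matrix:
  fixes \<sigma> :: "(real ^ 'n) measure"
  assumes \<sigma>: "symmetric_sphere_measure \<sigma>"
    and pos: "(INF e \<in> sphere 0 1. LINT y|\<sigma>. \<bar>e \<bullet> y\<bar>\<^sup>2) > 0"
  shows "sym_pos_def (Sigma_matrix \<sigma>)"
  unfolding sym_pos_def_def
proof (intro conjI allI impI)
  show "transpose (Sigma_matrix \<sigma>) = Sigma_matrix \<sigma>"
    by (simp add: transpose_def Sigma_matrix_def vec_eq_iff mult.commute)
  fix x :: "real ^ 'n" assume x: "x \<noteq> 0"
  have int: "integrable \<sigma> (\<lambda>y. (y \<bullet> x) *\<^sub>R y)"
    by (intro symmetric_sphere_measure_integrable[OF \<sigma>] continuous_intros)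
  have eq: "x \<bullet> (Sigma_matrix \<sigma> *v x) = (LINT y|\<sigma>. \<bar>x \<bullet> y\<bar>\<^sup>2)"
    using integral_inner_right[of x, OF int]
    by (simp add: Sigma_matrix_mult_vec[OF \<sigma>] power2_eq_square inner_commute)
  define e where "e = (1 / norm x) *\<^sub>R x"
  \<comment> \<open>The real infimum is a lower bound only for a family bounded below; here 0 is
    such a bound.\<close>
  have "(INF e \<in> sphere 0 1. LINT y|\<sigma>. \<bar>e \<bullet> y\<bar>\<^sup>2) \<le> (LINT y|\<sigma>. \<bar>e \<bullet> y\<bar>\<^sup>2)"
    using x by (intro cINF_lower bdd_belowI[of _ 0]) (auto simp: e_def)
  with pos have "(LINT y|\<sigma>. \<bar>e \<bullet> y\<bar>\<^sup>2) > 0" by linarith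
  also have "(LINT y|\<sigma>. \<bar>e \<bullet> y\<bar>\<^sup>2) = (LINT y|\<sigma>. (1 / (norm x)\<^sup>2) * \<bar>x \<bullet> y\<bar>\<^sup>2)"
    by (simp add: e_def power_divide)
  also have "\<dots> = (1 / (norm x)\<^sup>2) * (LINT y|\<sigma>. \<bar>x \<bullet> y\<bar>\<^sup>2)" by simp
  finally show "0 < x \<bullet> (Sigma_matrix \<sigma> *v x)"
    using x by (simp add: eq zero_less_divide_iff zero_less_mult_iff)
qed

text \<open>An injective linear map between finite-dimensional spaces is bounded below. The constant
  is fixed before \<open>f\<close> and \<open>x\<close>, so it depends on \<open>\<sigma>\<close>
  alone.\<close>

lemma aniso_gradient_lower_bound:
  fixes \<sigma> :: "(real ^ 'n) measure"
  assumes \<sigma>: "symmetric_sphere_measure \<sigma>"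
    and pos: "(INF e \<in> sphere 0 1. LINT y|\<sigma>. \<bar>e \<bullet> y\<bar>\<^sup>2) > 0"
  obtains c where "c > 0"
    "\<And>f x. c * norm (gradient f x)
        \<le> norm (matrix_inv_sqrt (Sigma_matrix \<sigma>) *v aniso_gradient \<sigma> f x)"
proof -
  define A where "A = Sigma_matrix \<sigma>"
  define g where "g = (\<lambda>v. matrix_inv_sqrt A *v (A *v v))"
  have A: "sym_pos_def A"
    unfolding A_def using \<sigma> pos by (rule sym_pos_def_Sigma_matrix)
  have lin: "linear g"
    unfolding g_def by (simp add: matrix_vector_mul_assoc matrix_vector_mul_linear)
  moreover have "inj g"
    unfolding linear_injective_0[OF lin]
    using A by (simp add: g_def sym_pos_def_eq_0_iff sym_pos_def_matrix_inv_sqrt)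
  ultimately obtain c where "c > 0" "\<And>v. c * norm v \<le> norm (g v)"
    using linear_inj_bounded_below_pos by (metis mult.commute)
  then show ?thesis
    by (intro that[of c])
      (simp_all add: g_def A_def Sigma_matrix_mult_vec[OF \<sigma>] aniso_gradient_def)
qed

section \<open>Powers and Hoelder for extended nonnegative functions\<close>

text \<open>Convention: \<open>epowr x 0 = 1\<close> also for \<open>x = 0\<close> and \<open>x = \<infinity>\<close>, so that exponents are additive
  on \<open>{0..}\<close>; only nonnegative exponents are meaningful, \<open>epowr 0 a = 0\<close> for \<open>a < 0\<close> being junk.\<close>

definition epowr :: "ennreal \<Rightarrow> real \<Rightarrow> ennreal" where
  "epowr x a = (if a = 0 then 1 else if x = \<infinity> then \<infinity> else ennreal (enn2real x powr a))"

lemma epowr_zero_right [simp]: "epowr x 0 = 1"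
  by (simp add: epowr_def)

lemma epowr_zero_left [simp]: "a \<noteq> 0 \<Longrightarrow> epowr 0 a = 0"
  by (simp add: epowr_def)

lemma epowr_top [simp]: "a \<noteq> 0 \<Longrightarrow> epowr top a = top"
  by (simp add: epowr_def)

lemma epowr_ennreal: "0 \<le> r \<Longrightarrow> a \<noteq> 0 \<Longrightarrow> epowr (ennreal r) a = ennreal (r powr a)"
  by (simp add: epowr_def)

lemma epowr_ennreal_pos: "0 < r \<Longrightarrow> epowr (ennreal r) a = ennreal (r powr a)"
  by (simp add: epowr_def)

lemma epowr_one_right [simp]: "epowr x 1 = x"
  by (cases x) (auto simp: epowr_ennreal)

lemma epowr_eq_0_iff: "epowr x a = 0 \<longleftrightarrow> x = 0 \<and> a \<noteq> 0"
  by (cases x) (auto simp: epowr_def)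

lemma epowr_eq_top_iff: "epowr x a = top \<longleftrightarrow> x = top \<and> a \<noteq> 0"
  by (cases x) (auto simp: epowr_def)

lemma epowr_mono: "x \<le> y \<Longrightarrow> 0 \<le> a \<Longrightarrow> epowr x a \<le> epowr y a"
  by (cases x; cases y) (auto simp: epowr_def intro!: ennreal_leI powr_mono2 dest: leD)

lemma epowr_add: "0 \<le> a \<Longrightarrow> 0 \<le> b \<Longrightarrow> epowr x (a + b) = epowr x a * epowr x b"
  by (cases x) (auto simp: epowr_def powr_add ennreal_mult add_nonneg_eq_0_iff)

lemma epowr_mult: "0 \<le> a \<Longrightarrow> epowr (x * y) a = epowr x a * epowr y a"
  by (cases x; cases y)
    (auto simp: epowr_def powr_mult ennreal_mult enn2real_mult ennreal_mult_top ennreal_top_mult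
      ennreal_mult_eq_top_iff)

lemma epowr_epowr: "0 \<le> a \<Longrightarrow> 0 \<le> b \<Longrightarrow> epowr (epowr x a) b = epowr x (a * b)"
  by (cases x) (auto simp: epowr_def powr_powr)

lemma epowr_of_nat_mult: "0 \<le> a \<Longrightarrow> epowr x (real n * a) = epowr x a ^ n"
  by (induction n) (simp_all add: distrib_right epowr_add)

lemma measurable_epowr [measurable]:
  assumes [measurable]: "f \<in> borel_measurable M"
  shows "(\<lambda>x. epowr (f x) a) \<in> borel_measurable M"
  unfolding epowr_def by (cases "a = 0") simp_all

text \<open>Convexity of \<open>exp\<close> at the logarithms of the \<open>x i\<close>. Values 0
  and \<open>top\<close> carrying positive weight are settled first, since they make one of the two
  sides trivial.\<close>

lemma weighted_AM_GM_ennreal: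
  fixes x :: "'i \<Rightarrow> ennreal"
  assumes S: "finite S" and w: "\<And>i. i \<in> S \<Longrightarrow> 0 \<le> w i" "sum w S = 1"
  shows "(\<Prod>i\<in>S. epowr (x i) (w i)) \<le> (\<Sum>i\<in>S. ennreal (w i) * x i)"
proof -
  consider (infinite) i where "i \<in> S" "w i > 0" "x i = top"
    | (zero) i where "i \<in> S" "w i > 0" "x i = 0"
    | (pos) "\<And>i. i \<in> S \<Longrightarrow> w i > 0 \<Longrightarrow> 0 < x i \<and> x i < top"
    by (metis less_top not_gr_zero)
  then show ?thesis
  proof cases
    case infinite
    then have "(\<Sum>i\<in>S. ennreal (w i) * x i) = top"
      using S by (auto simp: ennreal_mult_eq_top_iff intro!: bexI[of _ i])
    then show ?thesis by simp
  next
    case zero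
    then have "(\<Prod>i\<in>S. epowr (x i) (w i)) = 0"
      using S by (auto simp: epowr_eq_0_iff)
    then show ?thesis by (rule ord_eq_le_trans) simp
  next
    case pos
    \<comment> \<open>Where \<open>w i = 0\<close>, this may be a default value, but neither side of
      the inequality then depends on it.\<close>
    define y where "y i = ln (enn2real (x i))" for i
    have y: "epowr (x i) (w i) = ennreal (exp (w i * y i))"
      "ennreal (w i) * x i = ennreal (w i * exp (y i))" if i: "i \<in> S" for i
    proof -
      consider "w i = 0" | "w i > 0" using w(1)[OF i] by linarith
      then have "epowr (x i) (w i) = ennreal (exp (w i * y i)) \<and>
        ennreal (w i) * x i = ennreal (w i * exp (y i))"
      proof cases
        case 2
        then obtain r where "r > 0" "x i = ennreal r"
          using pos[OF i] by (cases "x i") auto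
        with 2 show ?thesis
          by (simp add: y_def epowr_ennreal_pos powr_def ennreal_mult)
      qed simp
      then show "epowr (x i) (w i) = ennreal (exp (w i * y i))"
        "ennreal (w i) * x i = ennreal (w i * exp (y i))" by auto
    qed
    have "S \<noteq> {}" using w by auto
    then have "exp (\<Sum>i\<in>S. w i * y i) \<le> (\<Sum>i\<in>S. w i * exp (y i))"
      using convex_on_sum[OF S _ exp_convex w(2) w(1), of y] by simp
    then show ?thesis
      using w S by (simp add: y prod_ennreal sum_ennreal exp_sum ennreal_leI cong: prod.cong sum.cong)
  qed
qed

text \<open>Each function is divided by its integral; the pointwise AM-GM inequality then integrates
  to the sum of the weights, which is 1. Integrals equal to 0 or \<open>top\<close> at positive
  weight are treated apart.\<close>

lemma nn_integral_Holder_prod: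
  fixes f :: "'i \<Rightarrow> 'a \<Rightarrow> ennreal"
  assumes S: "finite S" and w: "\<And>i. i \<in> S \<Longrightarrow> 0 \<le> w i" "sum w S = 1"
    and f[measurable]: "\<And>i. i \<in> S \<Longrightarrow> f i \<in> borel_measurable M"
  shows "(\<integral>\<^sup>+x. (\<Prod>i\<in>S. epowr (f i x) (w i)) \<partial>M) \<le> (\<Prod>i\<in>S. epowr (\<integral>\<^sup>+x. f i x \<partial>M) (w i))"
proof -
  define c where "c i = (\<integral>\<^sup>+x. f i x \<partial>M)" for i
  consider (zero) i where "i \<in> S" "w i > 0" "c i = 0"
    \<comment> \<open>Zero factors are excluded here because \<open>0 * top = 0\<close>, so a single
      infinite factor would not make the product infinite.\<close>
    | (infinite) i where "i \<in> S" "w i > 0" "c i = top" "\<And>j. j \<in> S \<Longrightarrow> w j > 0 \<Longrightarrow> c j \<noteq> 0"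
    | (pos) "\<And>i. i \<in> S \<Longrightarrow> w i > 0 \<Longrightarrow> c i \<noteq> 0 \<and> c i \<noteq> top"
    by metis
  then show ?thesis
  proof cases
    case zero
    then have "AE x in M. f i x = 0"
      using nn_integral_0_iff_AE[OF f] by (simp add: c_def)
    then have "AE x in M. (\<Prod>i\<in>S. epowr (f i x) (w i)) = 0"
      by eventually_elim (use zero S in \<open>auto simp: epowr_eq_0_iff\<close>)
    then have "(\<integral>\<^sup>+x. (\<Prod>i\<in>S. epowr (f i x) (w i)) \<partial>M) = (\<integral>\<^sup>+x. 0 \<partial>M)"
      by (rule nn_integral_cong_AE)
    then show ?thesis by simp
  next
    case infinite
    have "epowr (c j) (w j) \<noteq> 0" if "j \<in> S" for j
      using infinite(4)[OF that] w(1)[OF that] by (auto simp: epowr_eq_0_iff less_le)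
    moreover have "epowr (c i) (w i) = top"
      using infinite by simp
    ultimately have "(\<Prod>i\<in>S. epowr (c i) (w i)) = top"
      using S infinite(1) by (auto simp: ennreal_prod_eq_top)
    then show ?thesis by (simp add: c_def)
  next
    case pos
    have "epowr (f i x) (w i) = epowr (c i) (w i) * epowr (f i x / c i) (w i)" if "i \<in> S" for i x
    proof (cases "w i = 0")
      case False
      then have "c i \<noteq> 0" "c i \<noteq> top" using pos[OF that] w(1)[OF that] by auto
      then have "c i * (f i x / c i) = f i x"
        by (metis ennreal_divide_times ennreal_mult_divide_eq ennreal_times_divide mult.commute)
      then show ?thesis
        using epowr_mult[OF w(1)[OF that]] by metis
    qed simp
    then have "(\<integral>\<^sup>+x. (\<Prod>i\<in>S. epowr (f i x) (w i)) \<partial>M) =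
        (\<integral>\<^sup>+x. (\<Prod>i\<in>S. epowr (c i) (w i)) * (\<Prod>i\<in>S. epowr (f i x / c i) (w i)) \<partial>M)"
      by (simp add: prod.distrib cong: prod.cong)
    also have "\<dots> = (\<Prod>i\<in>S. epowr (c i) (w i)) * (\<integral>\<^sup>+x. (\<Prod>i\<in>S. epowr (f i x / c i) (w i)) \<partial>M)"
      by (intro nn_integral_cmult) measurable
    also have "(\<integral>\<^sup>+x. (\<Prod>i\<in>S. epowr (f i x / c i) (w i)) \<partial>M)
        \<le> (\<integral>\<^sup>+x. (\<Sum>i\<in>S. ennreal (w i) * (f i x / c i)) \<partial>M)"
      by (intro nn_integral_mono weighted_AM_GM_ennreal S w)
    also have "\<dots> = (\<Sum>i\<in>S. ennreal (w i) * (c i / c i))"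
      by (subst nn_integral_sum) (auto simp: nn_integral_cmult nn_integral_divide c_def)
    also have "\<dots> = (\<Sum>i\<in>S. ennreal (w i))"
    proof (intro sum.cong refl)
      fix i assume i: "i \<in> S"
      then show "ennreal (w i) * (c i / c i) = ennreal (w i)"
        using pos[OF i] w(1)[OF i] by (cases "w i = 0") (auto simp: less_top)
    qed
    also have "\<dots> = 1" using w by simp
    finally show ?thesis by (simp add: c_def mult_left_mono)
  qed
qed

text \<open>A Loomis--Whitney type inequality. In the induction step the new coordinate is integrated
  first: there the line integral in that direction is constant, and Hoelder with the exponents
  \<open>1 - m a\<close> and \<open>m\<close> times \<open>a\<close> reproduces the same expression for the marginal of \<open>g\<close>.\<close>

lemma (in product_sigma_finite) nn_integral_gridlines:
  fixes g :: "('i \<Rightarrow> 'a) \<Rightarrow> ennreal"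
  assumes "finite I" "g \<in> borel_measurable (PiM I M)" "0 \<le> a" "(real (card I) - 1) * a \<le> 1"
  shows "(\<integral>\<^sup>+x. epowr (g x) (1 - (real (card I) - 1) * a) *
            (\<Prod>i\<in>I. epowr (\<integral>\<^sup>+t. g (x(i := t)) \<partial>M i) a) \<partial>PiM I M)
          \<le> epowr (\<integral>\<^sup>+x. g x \<partial>PiM I M) (1 + a)"
  using assms
proof (induction I arbitrary: g rule: finite_induct)
  case empty
  \<comment> \<open>The subtraction is real, so \<open>card {} - 1\<close> counts as -1 and the
    exponent on the left is already \<open>1 + a\<close>.\<close>
  then show ?case by (simp add: PiM_empty nn_integral_count_space_finite)
next
  case (insert j I)
  note j = \<open>j \<notin> I\<close> and I = \<open>finite I\<close> and a = \<open>0 \<le> a\<close>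
  note g[measurable] = insert.prems(1)
  define m where "m = real (card I)"
  have card: "real (card (insert j I)) - 1 = m" using j I by (simp add: m_def)
  define b where "b = 1 - m * a"
  have b: "b \<ge> 0" using insert.prems(3) card by (simp add: b_def)
  define G where "G x = (\<integral>\<^sup>+y. g (x(j := y)) \<partial>M j)" for x
  have G[measurable]: "G \<in> borel_measurable (PiM I M)"
    unfolding G_def by measurable
  \<comment> \<open>Updating an index already present is an instance of adding a dimension, because
    the insertion is absorbed.\<close>
  have slice: "(\<lambda>x. \<integral>\<^sup>+t. g (x(i := t)) \<partial>M i) \<in> borel_measurable (PiM (insert j I) M)"
    if "i \<in> insert j I" for i
  proof -
    have "(\<lambda>z. (fst z)(i := snd z)) \<in>
        measurable (PiM (insert j I) M \<Otimes>\<^sub>M M i) (PiM (insert j I) M)"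
      using measurable_add_dim[of i "insert j I" M]
      by (simp only: insert_absorb[OF that] case_prod_unfold)
    from measurable_compose[OF this g] show ?thesis
      by (intro borel_measurable_nn_integral) (simp only: case_prod_unfold)
  qed
  have bound: "(\<integral>\<^sup>+y. epowr (g (x(j := y))) b *
        (\<Prod>i\<in>insert j I. epowr (\<integral>\<^sup>+t. g (x(j := y, i := t)) \<partial>M i) a) \<partial>M j)
      \<le> epowr (G x) (1 - (m - 1) * a) * (\<Prod>i\<in>I. epowr (\<integral>\<^sup>+t. G (x(i := t)) \<partial>M i) a)"
    if x: "x \<in> space (PiM I M)" for x
  proof -
    \<comment> \<open>The factors that vary with \<open>y\<close>: the slice of \<open>g\<close>
      with weight \<open>b\<close>, and the line integrals in the old directions with weight
      \<open>a\<close> each, so that \<open>b + m * a = 1\<close>. The line integral in direction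
      \<open>j\<close> equals \<open>G x\<close> and leaves the integral.\<close>
    define h where "h k y = (if k = j then g (x(j := y)) else \<integral>\<^sup>+t. g (x(j := y, k := t)) \<partial>M k)" for k y
    define w where "w k = (if k = j then b else a)" for k
    have upd[measurable]: "(\<lambda>y. x(j := y)) \<in> measurable (M j) (PiM (insert j I) M)"
      using x j by (rule measurable_component_update)
    have h[measurable]: "h k \<in> borel_measurable (M j)" if "k \<in> insert j I" for k
      using measurable_compose[OF upd g] measurable_compose[OF upd slice[OF that]]
      by (cases "k = j") (simp_all add: h_def[abs_def])
    have w: "sum w (insert j I) = 1" "\<And>k. k \<in> insert j I \<Longrightarrow> 0 \<le> w k"
    proof -
      have "sum w I = (\<Sum>k\<in>I. a)" using j by (intro sum.cong) (auto simp: w_def)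
      then show "sum w (insert j I) = 1" using j I by (simp add: w_def b_def m_def)
    qed (use a b in \<open>simp add: w_def\<close>)
    \<comment> \<open>By Tonelli, integrating out \<open>y\<close> turns line integrals of
      \<open>g\<close> into line integrals of its marginal \<open>G\<close>.\<close>
    have swap: "(\<integral>\<^sup>+y. h i y \<partial>M j) = (\<integral>\<^sup>+t. G (x(i := t)) \<partial>M i)" if i: "i \<in> I" for i
    proof -
      have ij: "i \<noteq> j" using i j by auto
      interpret ij: pair_sigma_finite "M i" "M j" ..
      have xi: "(\<lambda>t. x(i := t)) \<in> measurable (M i) (PiM I M)"
      proof -
        have "(\<lambda>t. (\<lambda>(x, t). x(i := t)) (x, t)) \<in> measurable (M i) (PiM (insert i I) M)"
          using x by (intro measurable_compose[OF _ measurable_add_dim] measurable_Pair) auto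
        then show ?thesis using i by (simp add: insert_absorb)
      qed
      have "(\<lambda>z. (\<lambda>(x, t). x(j := t)) (x(i := fst z), snd z)) \<in>
          measurable (M i \<Otimes>\<^sub>M M j) (PiM (insert j I) M)"
        by (intro measurable_compose[OF _ measurable_add_dim] measurable_Pair
            measurable_compose[OF measurable_fst xi] measurable_snd)
      then have "(\<lambda>z. x(i := fst z, j := snd z)) \<in> measurable (M i \<Otimes>\<^sub>M M j) (PiM (insert j I) M)"
        by (simp only: prod.case)
      from measurable_compose[OF this g]
      have "case_prod (\<lambda>t y. g (x(i := t, j := y))) \<in> borel_measurable (M i \<Otimes>\<^sub>M M j)"
        by (simp only: case_prod_unfold)
      from ij.Fubini'[OF this] show ?thesis
        using ij by (simp add: h_def G_def fun_upd_twist)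
    qed
    have "(\<integral>\<^sup>+y. epowr (g (x(j := y))) b *
          (\<Prod>i\<in>insert j I. epowr (\<integral>\<^sup>+t. g (x(j := y, i := t)) \<partial>M i) a) \<partial>M j)
        = (\<integral>\<^sup>+y. epowr (G x) a * (\<Prod>k\<in>insert j I. epowr (h k y) (w k)) \<partial>M j)"
    proof (intro nn_integral_cong)
      fix y
      have "(\<Prod>i\<in>I. epowr (\<integral>\<^sup>+t. g (x(j := y, i := t)) \<partial>M i) a) = (\<Prod>k\<in>I. epowr (h k y) (w k))"
        using j by (intro prod.cong) (auto simp: h_def w_def)
      then show "epowr (g (x(j := y))) b *
          (\<Prod>i\<in>insert j I. epowr (\<integral>\<^sup>+t. g (x(j := y, i := t)) \<partial>M i) a) =
          epowr (G x) a * (\<Prod>k\<in>insert j I. epowr (h k y) (w k))"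
        using j I by (simp add: h_def w_def G_def mult_ac)
    qed
    also have "\<dots> = epowr (G x) a * (\<integral>\<^sup>+y. (\<Prod>k\<in>insert j I. epowr (h k y) (w k)) \<partial>M j)"
      by (intro nn_integral_cmult) measurable
    also have "\<dots> \<le> epowr (G x) a * (\<Prod>k\<in>insert j I. epowr (\<integral>\<^sup>+y. h k y \<partial>M j) (w k))"
      using I by (intro mult_left_mono nn_integral_Holder_prod w h) auto
    also have "(\<Prod>k\<in>insert j I. epowr (\<integral>\<^sup>+y. h k y \<partial>M j) (w k))
        = epowr (G x) b * (\<Prod>i\<in>I. epowr (\<integral>\<^sup>+t. G (x(i := t)) \<partial>M i) a)"
    proof -
      have "(\<Prod>k\<in>I. epowr (\<integral>\<^sup>+y. h k y \<partial>M j) (w k)) = (\<Prod>i\<in>I. epowr (\<integral>\<^sup>+t. G (x(i := t)) \<partial>M i) a)"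
        using j by (intro prod.cong) (auto simp: swap w_def)
      then show ?thesis using j I by (simp add: h_def w_def G_def)
    qed
    also have "epowr (G x) a * (epowr (G x) b * (\<Prod>i\<in>I. epowr (\<integral>\<^sup>+t. G (x(i := t)) \<partial>M i) a))
        = epowr (G x) (a + b) * (\<Prod>i\<in>I. epowr (\<integral>\<^sup>+t. G (x(i := t)) \<partial>M i) a)"
      using a b by (simp add: epowr_add mult.assoc)
    \<comment> \<open>Exactly the exponent in the induction hypothesis for \<open>I\<close>, whose
      cardinality is \<open>m\<close>.\<close>
    also have "a + b = 1 - (m - 1) * a" by (simp add: b_def algebra_simps)
    finally show ?thesis .
  qed
  have "(\<integral>\<^sup>+x. epowr (g x) (1 - (real (card (insert j I)) - 1) * a) *
      (\<Prod>i\<in>insert j I. epowr (\<integral>\<^sup>+t. g (x(i := t)) \<partial>M i) a) \<partial>PiM (insert j I) M)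
    = (\<integral>\<^sup>+x. (\<integral>\<^sup>+y. epowr (g (x(j := y))) b *
        (\<Prod>i\<in>insert j I. epowr (\<integral>\<^sup>+t. g (x(j := y, i := t)) \<partial>M i) a) \<partial>M j) \<partial>PiM I M)"
    unfolding card b_def[symmetric]
    by (intro product_nn_integral_insert I j borel_measurable_times_ennreal measurable_epowr g
        borel_measurable_prod_ennreal slice)
  also have "\<dots> \<le> (\<integral>\<^sup>+x. epowr (G x) (1 - (m - 1) * a) *
      (\<Prod>i\<in>I. epowr (\<integral>\<^sup>+t. G (x(i := t)) \<partial>M i) a) \<partial>PiM I M)"
    by (intro nn_integral_mono bound)
  also have "\<dots> \<le> epowr (\<integral>\<^sup>+x. G x \<partial>PiM I M) (1 + a)"
  proof -
    have "(m - 1) * a \<le> 1" using b a by (simp add: b_def algebra_simps)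
    then show ?thesis unfolding m_def by (rule insert.IH[OF G a])
  qed
  also have "(\<integral>\<^sup>+x. G x \<partial>PiM I M) = (\<integral>\<^sup>+x. g x \<partial>PiM (insert j I) M)"
    unfolding G_def by (rule product_nn_integral_insert[symmetric]) (use I j g in auto)
  finally show ?case .
qed

text \<open>The power \<open>u x\<close> to \<open>r\<close> is split into one factor with exponent
  \<open>a\<close> for each basis vector, and each factor is bounded by the line integral in its own
  direction. The map \<open>T\<close> carries the product inequality over to the Euclidean
  space.\<close>

lemma nn_integral_lborel_gridlines:
  fixes u g :: "'a::euclidean_space \<Rightarrow> ennreal"
  assumes [measurable]: "u \<in> borel_measurable borel" "g \<in> borel_measurable borel"
    and dim: "DIM('a) \<ge> 2"
    and le: "\<And>x b. b \<in> Basis \<Longrightarrow> u x \<le> (\<integral>\<^sup>+t. g (x + (t - x \<bullet> b) *\<^sub>R b) \<partial>lborel)"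
  defines "r \<equiv> real DIM('a) / (real DIM('a) - 1)"
  shows "(\<integral>\<^sup>+x. epowr (u x) r \<partial>lborel) \<le> epowr (\<integral>\<^sup>+x. g x \<partial>lborel) r"
proof -
  interpret product_sigma_finite "\<lambda>_ :: 'a. lborel :: real measure" ..
  define T :: "('a \<Rightarrow> real) \<Rightarrow> 'a" where "T x = (\<Sum>b\<in>Basis. x b *\<^sub>R b)" for x
  have T[measurable]: "T \<in> borel_measurable (\<Pi>\<^sub>M b\<in>Basis. lborel)"
    unfolding T_def by measurable
  have int: "(\<integral>\<^sup>+x. h x \<partial>lborel) = (\<integral>\<^sup>+x. h (T x) \<partial>(\<Pi>\<^sub>M b\<in>Basis. lborel))"
    if [measurable]: "h \<in> borel_measurable borel" for h :: "'a \<Rightarrow> ennreal"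
    unfolding lborel_eq[where 'a='a] T_def[symmetric] by (subst nn_integral_distr) auto
  \<comment> \<open>The largest exponent that \<open>nn_integral_gridlines\<close> admits; it makes
    the exponent of the factor \<open>g\<close> vanish.\<close>
  define a where "a = 1 / (real DIM('a) - 1)"
  have a: "a \<ge> 0" "(real DIM('a) - 1) * a = 1" "r = real DIM('a) * a" "r = 1 + a"
    using dim by (simp_all add: a_def r_def field_simps)
  have T_upd: "T (x(b := t)) = T x + (t - T x \<bullet> b) *\<^sub>R b" if "b \<in> Basis" for x b t
  proof -
    have "T (x(b := t)) = (\<Sum>c\<in>Basis. x c *\<^sub>R c + (if c = b then (t - x b) *\<^sub>R b else 0))"
      unfolding T_def by (intro sum.cong) (auto simp: algebra_simps)
    then show ?thesis using that by (simp add: sum.distrib T_def)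
  qed
  have "(\<integral>\<^sup>+x. epowr (u x) r \<partial>lborel)
      = (\<integral>\<^sup>+x. (\<Prod>b\<in>(Basis::'a set). epowr (u (T x)) a) \<partial>(\<Pi>\<^sub>M b\<in>Basis. lborel))"
    by (subst int) (simp_all add: a epowr_of_nat_mult)
  also have "\<dots> \<le> (\<integral>\<^sup>+x. (\<Prod>b\<in>Basis. epowr (\<integral>\<^sup>+t. g (T (x(b := t))) \<partial>lborel) a) \<partial>(\<Pi>\<^sub>M b\<in>Basis. lborel))"
    using a(1) by (intro nn_integral_mono prod_mono_ennreal epowr_mono) (auto simp: T_upd le)
  \<comment> \<open>The inserted factor has exponent 0 and is 1 by convention, even where
    \<open>g\<close> is 0 or infinite.\<close>
  also have "\<dots> = (\<integral>\<^sup>+x. epowr (g (T x)) (1 - (real DIM('a) - 1) * a) *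
      (\<Prod>b\<in>Basis. epowr (\<integral>\<^sup>+t. g (T (x(b := t))) \<partial>lborel) a) \<partial>(\<Pi>\<^sub>M b\<in>Basis. lborel))"
    by (simp add: a(2))
  also have "\<dots> \<le> epowr (\<integral>\<^sup>+x. g (T x) \<partial>(\<Pi>\<^sub>M b\<in>Basis. lborel)) (1 + a)"
    by (rule nn_integral_gridlines) (use a in simp_all)
  also have "\<dots> = epowr (\<integral>\<^sup>+x. g x \<partial>lborel) r"
    by (subst int) (simp_all flip: a(4))
  finally show ?thesis .
qed

section \<open>The Sobolev inequality\<close>

text \<open>The fundamental theorem of calculus, started at a zero of \<open>F\<close>; enlarging
  the interval to the whole line removes \<open>s\<close> and \<open>t\<close> from the
  bound.\<close>

lemma abs_le_nn_integral_derivative: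
  fixes F f :: "real \<Rightarrow> real"
  assumes F: "\<And>t. (F has_real_derivative f t) (at t)" and f: "continuous_on UNIV f"
    and s: "s \<le> t" "F s = 0"
  shows "ennreal \<bar>F t\<bar> \<le> (\<integral>\<^sup>+x. ennreal \<bar>f x\<bar> \<partial>lborel)"
proof -
  have [measurable]: "f \<in> borel_measurable borel"
    using f by (rule borel_measurable_continuous_onI)
  have fcont: "isCont f x" for x
    using f by (simp add: continuous_on_eq_continuous_at)
  have int: "has_bochner_integral lborel (\<lambda>x. f x * indicator {s..t} x) (F t - F s)"
    using F fcont s(1) by (intro has_bochner_integral_FTC_Icc_real) auto
  have "ennreal \<bar>F t\<bar> = ennreal (norm (LINT x|lborel. f x * indicator {s..t} x))"
    using has_bochner_integral_integral_eq[OF int] s(2) by simp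
  also have "\<dots> \<le> (\<integral>\<^sup>+x. norm (f x * indicator {s..t} x) \<partial>lborel)"
    by (rule integral_norm_bound_ennreal) (use int in \<open>auto simp: has_bochner_integral_iff\<close>)
  also have "\<dots> \<le> (\<integral>\<^sup>+x. ennreal \<bar>f x\<bar> \<partial>lborel)"
    by (intro nn_integral_mono ennreal_leI) (auto simp: indicator_def)
  finally show ?thesis .
qed

text \<open>This is \<open>sgn x * \<bar>x\<bar> powr a\<close>; written with positive and negative
  parts, its continuity across 0 for positive \<open>a\<close> follows from that of
  \<open>powr\<close>.\<close>

definition signed_powr :: "real \<Rightarrow> real \<Rightarrow> real" where
  "signed_powr x a = max x 0 powr a - max (- x) 0 powr a"

lemma abs_signed_powr: "\<bar>signed_powr x a\<bar> = \<bar>x\<bar> powr a"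
  by (cases "x \<ge> 0") (auto simp: signed_powr_def max_def)

lemma continuous_on_signed_powr:
  assumes "a > 0" "continuous_on S f"
  shows "continuous_on S (\<lambda>x. signed_powr (f x) a)"
  unfolding signed_powr_def using assms by (intro continuous_intros continuous_on_powr') auto

text \<open>Away from 0 this is the power rule on a half-line. At 0 the difference quotient has
  absolute value \<open>\<bar>h\<bar> powr (a - 1)\<close>, which tends to 0 because
  \<open>a > 1\<close>.\<close>

lemma has_real_derivative_abs_powr:
  assumes a: "a > 1"
  shows "((\<lambda>x. \<bar>x\<bar> powr a) has_real_derivative a * signed_powr x (a - 1)) (at x)"
proof -
  consider "x > 0" | "x < 0" | "x = 0" by linarith
  then show ?thesis
  proof cases
    case 1
    have "((\<lambda>x. x powr a) has_real_derivative a * signed_powr x (a - 1)) (at x)"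
      using 1 by (auto intro!: derivative_eq_intros simp: signed_powr_def powr_diff)
    then show ?thesis
      by (rule has_field_derivative_transform_within_open[of _ _ _ "{0<..}"]) (use 1 in auto)
  next
    case 2
    have "((\<lambda>x. (- x) powr a) has_real_derivative a * signed_powr x (a - 1)) (at x)"
      using 2 by (auto intro!: derivative_eq_intros simp: signed_powr_def powr_diff)
    then show ?thesis
      by (rule has_field_derivative_transform_within_open[of _ _ _ "{..<0}"]) (use 2 in auto)
  next
    case 3
    have "((\<lambda>h::real. \<bar>h\<bar> powr (a - 1)) \<longlongrightarrow> 0) (at 0)"
      using tendsto_powr'[of "\<lambda>h::real. \<bar>h\<bar>" 0 "at 0" "\<lambda>_. a - 1" "a - 1"] a
      by (simp add: tendsto_rabs_zero)
    then have "((\<lambda>h::real. \<bar>h\<bar> powr a / h) \<longlongrightarrow> 0) (at 0)"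
      by (rule Lim_null_comparison[rotated])
        (auto simp: eventually_at_filter powr_diff intro!: always_eventually)
    then show ?thesis
      using 3 a by (simp add: has_field_derivative_iff signed_powr_def)
  qed
qed

text \<open>The derivative of \<open>\<bar>f\<bar> powr \<gamma>\<close> is integrated along the
  line through \<open>x\<close> in direction \<open>b\<close>, starting at a point where
  \<open>f\<close> vanishes.\<close>

lemma abs_powr_le_nn_integral_slice:
  fixes f :: "'a::euclidean_space \<Rightarrow> real" and G :: "'a \<Rightarrow> 'a"
  assumes f: "\<And>x. (f has_derivative (\<lambda>h. G x \<bullet> h)) (at x)" and G: "continuous_on UNIV G"
    and supp: "\<And>x. norm x > R \<Longrightarrow> f x = 0" and \<gamma>: "\<gamma> > 1" and b: "b \<in> Basis"
  shows "ennreal (\<bar>f x\<bar> powr \<gamma>) \<le> (\<integral>\<^sup>+t. (\<lambda>y. ennreal (\<gamma> * (\<bar>f y\<bar> powr (\<gamma> - 1) * norm (G y))))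
            (x + (t - x \<bullet> b) *\<^sub>R b) \<partial>lborel)"
proof -
  \<comment> \<open>The parameter is the \<open>b\<close>-coordinate of the point, so
    \<open>y (x \<bullet> b) = x\<close>.\<close>
  define y where "y t = x + (t - x \<bullet> b) *\<^sub>R b" for t
  define F where "F t = \<bar>f (y t)\<bar> powr \<gamma>" for t
  define F' where "F' t = \<gamma> * signed_powr (f (y t)) (\<gamma> - 1) * (G (y t) \<bullet> b)" for t
  have y_cont: "continuous_on UNIV y" unfolding y_def by (intro continuous_intros)
  have f_cont: "continuous_on UNIV f"
    using f has_derivative_continuous by (metis continuous_at_imp_continuous_on)
  have "(F has_real_derivative F' t) (at t)" for t
  proof -
    have "(y has_derivative (\<lambda>h. h *\<^sub>R b)) (at t)"
      unfolding y_def by (auto intro!: derivative_eq_intros)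
    from has_derivative_compose[OF this f]
    have "((\<lambda>t. f (y t)) has_real_derivative G (y t) \<bullet> b) (at t)"
      by (simp add: has_field_derivative_def mult_commute_abs)
    from DERIV_chain2[OF has_real_derivative_abs_powr[OF \<gamma>] this]
    show ?thesis by (simp add: F_def[abs_def] F'_def)
  qed
  moreover have "continuous_on UNIV F'"
    unfolding F'_def using \<gamma>
    by (intro continuous_intros continuous_on_signed_powr
        continuous_on_compose2[OF f_cont y_cont] continuous_on_compose2[OF G y_cont]) auto
  \<comment> \<open>A parameter to the left of \<open>x \<bullet> b\<close> with
    \<open>\<bar>s\<bar> > R\<close>, whatever the sign of \<open>R\<close>.\<close>
  moreover define s where "s = min (x \<bullet> b) (- \<bar>R\<bar> - 1)"
  have "norm (y s) > R"
  proof -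
    have "y s \<bullet> b = s" using b by (simp add: y_def inner_add_left)
    then have "\<bar>s\<bar> \<le> norm (y s)" using Basis_le_norm[OF b, of "y s"] by simp
    then show ?thesis by (simp add: s_def)
  qed
  then have "s \<le> x \<bullet> b" "F s = 0" using supp by (simp_all add: s_def F_def)
  ultimately have "ennreal \<bar>F (x \<bullet> b)\<bar> \<le> (\<integral>\<^sup>+t. ennreal \<bar>F' t\<bar> \<partial>lborel)"
    by (rule abs_le_nn_integral_derivative)
  also have "\<dots> \<le> (\<integral>\<^sup>+t. ennreal (\<gamma> * (\<bar>f (y t)\<bar> powr (\<gamma> - 1) * norm (G (y t)))) \<partial>lborel)"
  proof (intro nn_integral_mono ennreal_leI)
    fix t
    have "\<bar>G (y t) \<bullet> b\<bar> \<le> norm (G (y t))" using Basis_le_norm[OF b] .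
    then show "\<bar>F' t\<bar> \<le> \<gamma> * (\<bar>f (y t)\<bar> powr (\<gamma> - 1) * norm (G (y t)))"
      using \<gamma> by (simp add: F'_def abs_mult abs_signed_powr mult_left_mono)
  qed
  finally show ?thesis by (simp add: F_def y_def)
qed

text \<open>With \<open>X\<close> and \<open>Y\<close> the integrals on the two sides, the gridline
  inequality and Hoelder bound \<open>X\<close> to the power \<open>1 / r\<close> by
  \<open>\<gamma>\<close> times \<open>X\<close> to the power \<open>1 - 1 / p\<close> times
  \<open>Y\<close> to the power \<open>1 / p\<close>. Cancelling the power of \<open>X\<close> on
  the right leaves the exponent \<open>1 / q\<close>.\<close>

lemma Gagliardo_Nirenberg_Sobolev:
  fixes f :: "'a::euclidean_space \<Rightarrow> real" and G :: "'a \<Rightarrow> 'a" and p :: real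
  assumes f: "\<And>x. (f has_derivative (\<lambda>h. G x \<bullet> h)) (at x)" and G: "continuous_on UNIV G"
    and supp: "\<And>x. norm x > R \<Longrightarrow> f x = 0"
    and p: "1 < p" "p < DIM('a)"
  defines "q \<equiv> p * real DIM('a) / (real DIM('a) - p)"
  shows "epowr (\<integral>\<^sup>+x. ennreal (\<bar>f x\<bar> powr q) \<partial>lborel) (1 / q)
    \<le> ennreal (p * (real DIM('a) - 1) / (real DIM('a) - p)) *
        epowr (\<integral>\<^sup>+x. ennreal (norm (G x) powr p) \<partial>lborel) (1 / p)"
proof -
  define n where "n = real DIM('a)"
  \<comment> \<open>The power making \<open>\<bar>f\<bar> powr (\<gamma> * n / (n - 1))\<close> and \<open>(\<bar>f\<bar> powr (\<gamma> - 1)) powr (p / (p - 1))\<close>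
    both equal to \<open>\<bar>f\<bar> powr q\<close>.\<close>
  define \<gamma> where "\<gamma> = p * (n - 1) / (n - p)"
  define r where "r = n / (n - 1)"
  have n: "p < n" "DIM('a) \<ge> 2" using p by (auto simp: n_def)
  have q: "q > 0" "q = p * n / (n - p)" using p n by (simp_all add: q_def n_def)
  have \<gamma>: "\<gamma> > 1"
  proof -
    have "n - p < p * (n - 1)" using mult_strict_right_mono[of 1 p n] p n by (simp add: algebra_simps)
    then show ?thesis using n by (simp add: \<gamma>_def)
  qed
  have r: "r > 0" using p n by (simp add: r_def)
  have exps: "\<gamma> * r = q" "q * (1 - 1 / p) = \<gamma> - 1" "1 / r = (1 - 1 / p) + 1 / q"
    using p n by (simp_all add: \<gamma>_def r_def q divide_simps) (simp_all add: algebra_simps)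
  have f_cont: "continuous_on UNIV f"
    using f has_derivative_continuous by (metis continuous_at_imp_continuous_on)
  have [measurable]: "f \<in> borel_measurable borel" "G \<in> borel_measurable borel"
    using f_cont G by (simp_all add: borel_measurable_continuous_onI)
  define X where "X = (\<integral>\<^sup>+x. ennreal (\<bar>f x\<bar> powr q) \<partial>lborel)"
  define Y where "Y = (\<integral>\<^sup>+x. ennreal (norm (G x) powr p) \<partial>lborel)"
  \<comment> \<open>Finiteness is what permits the final cancellation; \<open>f\<close> is
    continuous and vanishes outside a ball.\<close>
  have X_finite: "X < \<infinity>"
  proof -
    have "bounded (f ` cball 0 R)"
      using f_cont by (intro compact_imp_bounded compact_continuous_image)
        (auto intro: continuous_on_subset)
    then obtain K where K: "\<And>x. x \<in> cball 0 R \<Longrightarrow> \<bar>f x\<bar> \<le> K"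
      unfolding bounded_iff by (metis imageI real_norm_def)
    have "X \<le> (\<integral>\<^sup>+x. ennreal (K powr q) * indicator (cball (0::'a) R) x \<partial>lborel)"
      unfolding X_def
    proof (intro nn_integral_mono)
      fix x
      show "ennreal (\<bar>f x\<bar> powr q) \<le> ennreal (K powr q) * indicator (cball (0::'a) R) x"
        using K[of x] supp[of x] q
        by (cases "norm x > R") (auto simp: indicator_def intro!: ennreal_leI powr_mono2)
    qed
    also have "\<dots> < \<infinity>"
      using emeasure_lborel_cball_finite[of "0::'a" R]
      by (simp add: nn_integral_cmult_indicator ennreal_mult_less_top)
    finally show ?thesis .
  qed
  have Holder: "(\<integral>\<^sup>+x. ennreal (\<bar>f x\<bar> powr (\<gamma> - 1) * norm (G x)) \<partial>lborel)
      \<le> epowr X (1 - 1 / p) * epowr Y (1 / p)"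
  proof -
    \<comment> \<open>Hoelder for two functions, indexed by \<open>bool\<close>, with weights
      \<open>1 - 1 / p\<close> and \<open>1 / p\<close>.\<close>
    define h where "h i x = ennreal (if i then \<bar>f x\<bar> powr q else norm (G x) powr p)" for i x
    define w where "w i = (if i then 1 - 1 / p else 1 / p)" for i
    have "(\<integral>\<^sup>+x. (\<Prod>i\<in>UNIV. epowr (h i x) (w i)) \<partial>lborel)
        \<le> (\<Prod>i\<in>UNIV. epowr (\<integral>\<^sup>+x. h i x \<partial>lborel) (w i))"
    proof (rule nn_integral_Holder_prod)
      show "h i \<in> borel_measurable lborel" for i
        unfolding h_def by (cases i) simp_all
    qed (use p in \<open>auto simp: w_def UNIV_bool\<close>)
    moreover have "(\<Prod>i\<in>UNIV. epowr (h i x) (w i)) = ennreal (\<bar>f x\<bar> powr (\<gamma> - 1) * norm (G x))" for x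
      using p by (simp add: UNIV_bool h_def w_def epowr_ennreal powr_powr exps ennreal_mult mult.commute)
    ultimately show ?thesis
      by (simp add: UNIV_bool h_def w_def X_def Y_def mult.commute)
  qed
  have "X = (\<integral>\<^sup>+x. epowr (ennreal (\<bar>f x\<bar> powr \<gamma>)) r \<partial>lborel)"
    using r by (simp add: X_def epowr_ennreal powr_powr exps)
  also have "\<dots> \<le> epowr (\<integral>\<^sup>+x. ennreal (\<gamma> * (\<bar>f x\<bar> powr (\<gamma> - 1) * norm (G x))) \<partial>lborel) r"
    unfolding r_def n_def
    by (rule nn_integral_lborel_gridlines)
      (use n in \<open>simp_all add: abs_powr_le_nn_integral_slice[OF f G supp \<gamma>]\<close>)
  also have "(\<integral>\<^sup>+x. ennreal (\<gamma> * (\<bar>f x\<bar> powr (\<gamma> - 1) * norm (G x))) \<partial>lborel)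
      = ennreal \<gamma> * (\<integral>\<^sup>+x. ennreal (\<bar>f x\<bar> powr (\<gamma> - 1) * norm (G x)) \<partial>lborel)"
    using \<gamma> by (subst nn_integral_cmult[symmetric]) (simp_all add: ennreal_mult)
  also have "epowr \<dots> r \<le> epowr (ennreal \<gamma> * (epowr X (1 - 1 / p) * epowr Y (1 / p))) r"
    using r Holder by (intro epowr_mono mult_left_mono) auto
  finally have "epowr X (1 / r) \<le> epowr (epowr (ennreal \<gamma> * (epowr X (1 - 1 / p) * epowr Y (1 / p))) r) (1 / r)"
    using r by (intro epowr_mono) auto
  also have "\<dots> = epowr X (1 - 1 / p) * (ennreal \<gamma> * epowr Y (1 / p))"
    using r by (simp add: epowr_epowr mult_ac)
  also have "epowr X (1 / r) = epowr X (1 - 1 / p) * epowr X (1 / q)"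
    unfolding exps(3) using p q(1) by (intro epowr_add) simp_all
  finally have le: "epowr X (1 - 1 / p) * epowr X (1 / q) \<le> epowr X (1 - 1 / p) * (ennreal \<gamma> * epowr Y (1 / p))" .
  have "epowr X (1 / q) \<le> ennreal \<gamma> * epowr Y (1 / p)"
  proof (cases "X = 0")
    case False
    then have "epowr X (1 - 1 / p) \<noteq> 0" "epowr X (1 - 1 / p) < top"
      using X_finite by (auto simp: epowr_eq_0_iff epowr_eq_top_iff less_top[symmetric])
    with le show ?thesis
      by (subst (asm) ennreal_mult_le_mult_iff) auto
  qed (use q(1) in simp)
  then show ?thesis by (simp add: X_def Y_def \<gamma>_def n_def)
qed


section \<open>The anisotropic Sobolev inequality\<close>

lemma Lp_norm_eq_epowr:
  assumes "p > 0"
  shows "Lp_norm p f = epowr (\<integral>\<^sup>+x. ennreal (norm (f x) powr p) \<partial>lborel) (1 / p)"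
  using assms by (simp add: Lp_norm_def epowr_def Let_def)

text \<open>Homogeneity and monotonicity of the norm: the constant moves under the integral as
  \<open>c powr p\<close>, and the pointwise bound applies there.\<close>

lemma Lp_norm_mono_const:
  assumes p: "p > 0" and c: "c > 0" and le: "\<And>x. c * norm (f x) \<le> norm (g x)"
    and [measurable]: "f \<in> borel_measurable borel"
  shows "ennreal c * Lp_norm p f \<le> Lp_norm p g"
proof -
  have "ennreal c * Lp_norm p f = epowr (ennreal (c powr p) * (\<integral>\<^sup>+x. ennreal (norm (f x) powr p) \<partial>lborel)) (1 / p)"
    using p c by (simp add: Lp_norm_eq_epowr epowr_mult epowr_ennreal powr_powr)
  also have "ennreal (c powr p) * (\<integral>\<^sup>+x. ennreal (norm (f x) powr p) \<partial>lborel)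
      = (\<integral>\<^sup>+x. ennreal ((c * norm (f x)) powr p) \<partial>lborel)"
    using c by (subst nn_integral_cmult[symmetric]) (simp_all add: powr_mult ennreal_mult)
  also have "epowr \<dots> (1 / p) \<le> Lp_norm p g"
    unfolding Lp_norm_eq_epowr[OF p] using p c le
    by (intro epowr_mono nn_integral_mono ennreal_leI powr_mono2) auto
  finally show ?thesis .
qed

text \<open>Supplies what the Sobolev inequality assumes. The derivative is linear, hence determined
  by its values on the axis vectors, which are the entries of \<open>gradient f x\<close>.\<close>

lemma smooth_compact_supportD:
  fixes f :: "real ^ 'n \<Rightarrow> real"
  assumes "f \<in> smooth_compact_support"
  shows "(f has_derivative (\<lambda>h. gradient f x \<bullet> h)) (at x)"
    and "continuous_on UNIV (gradient f)"
    and "\<exists>R. \<forall>x. norm x > R \<longrightarrow> f x = 0"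
proof -
  have "Ck 1 f" and compact: "compact (closure {x. f x \<noteq> 0})"
    using assms by (auto simp: smooth_compact_support_def)
  then have diff: "f differentiable (at x)" and cont: "continuous_on UNIV (\<lambda>x. gradient f x $ i)" for x i
    by simp_all
  have "continuous_on UNIV (\<lambda>x. \<chi> i. gradient f x $ i)"
    using cont by (rule continuous_on_vec_lambda)
  then show "continuous_on UNIV (gradient f)" by simp
  have D: "(f has_derivative frechet_derivative f (at x)) (at x)"
    using diff frechet_derivative_works by blast
  interpret D: linear "frechet_derivative f (at x)"
    using D by (rule has_derivative_linear)
  have "frechet_derivative f (at x) h = gradient f x \<bullet> h" for h
  proof -
    have "frechet_derivative f (at x) h = frechet_derivative f (at x) (\<Sum>i\<in>UNIV. h $ i *\<^sub>R axis i 1)"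
      by (simp add: basis_expansion flip: scalar_mult_eq_scaleR)
    also have "\<dots> = gradient f x \<bullet> h"
      by (simp add: D.sum D.scale gradient_def inner_vec_def mult.commute)
    finally show ?thesis .
  qed
  then show "(f has_derivative (\<lambda>h. gradient f x \<bullet> h)) (at x)"
    using D by presburger
  obtain R where R: "\<And>x. x \<in> closure {x. f x \<noteq> 0} \<Longrightarrow> norm x \<le> R"
    using compact_imp_bounded[OF compact] by (auto simp: bounded_iff)
  show "\<exists>R. \<forall>x. norm x > R \<longrightarrow> f x = 0"
    using R closure_subset[of "{x. f x \<noteq> 0}"] by (metis (mono_tags) leD mem_Collect_eq subsetD)
qed

theorem theorem4p1:
  fixes \<sigma> :: "(real ^ 'n) measure" and p q :: real
  assumes "CARD('n) \<ge> 2"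
    and "symmetric_sphere_measure \<sigma>"
    and "(INF e \<in> sphere 0 1. LINT y|\<sigma>. \<bar>e \<bullet> y\<bar>\<^sup>2) > 0"
    and "1 < p" and "p < real CARD('n)"
    and "q = p * real CARD('n) / (real CARD('n) - p)"
  shows "\<exists>C > 0. \<forall>f \<in> smooth_compact_support.
           Lp_norm q f \<le> ennreal C *
             Lp_norm p (\<lambda>x. matrix_inv_sqrt (Sigma_matrix \<sigma>) *v aniso_gradient \<sigma> f x)"
proof -
  obtain c where c: "c > 0" "\<And>f x. c * norm (gradient f x)
      \<le> norm (matrix_inv_sqrt (Sigma_matrix \<sigma>) *v aniso_gradient \<sigma> f x)"
    using aniso_gradient_lower_bound[OF assms(2,3)] by blast
  define \<gamma> where "\<gamma> = p * (real CARD('n) - 1) / (real CARD('n) - p)"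
  have \<gamma>: "\<gamma> > 0" using assms by (simp add: \<gamma>_def)
  have q: "q > 0" using assms by simp
  \<comment> \<open>Here \<open>\<gamma>\<close> is the Sobolev constant and \<open>c\<close> the
    lower bound for the matrix map; both are fixed before \<open>f\<close>.\<close>
  have "Lp_norm q f \<le> ennreal (\<gamma> / c) *
      Lp_norm p (\<lambda>x. matrix_inv_sqrt (Sigma_matrix \<sigma>) *v aniso_gradient \<sigma> f x)"
    if f: "f \<in> smooth_compact_support" for f
  proof -
    note fD = smooth_compact_supportD[OF f]
    obtain R where R: "\<And>x. norm x > R \<Longrightarrow> f x = 0" using fD(3) by blast
    have "Lp_norm q f \<le> ennreal \<gamma> * Lp_norm p (gradient f)"
      using Gagliardo_Nirenberg_Sobolev[OF fD(1,2) R, where p = p] assms(4-6) q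
      by (simp add: Lp_norm_eq_epowr \<gamma>_def)
    also have "\<dots> = ennreal (\<gamma> / c) * (ennreal c * Lp_norm p (gradient f))"
      using \<gamma> c(1) by (simp flip: ennreal_mult mult.assoc)
    also have "\<dots> \<le> ennreal (\<gamma> / c) *
        Lp_norm p (\<lambda>x. matrix_inv_sqrt (Sigma_matrix \<sigma>) *v aniso_gradient \<sigma> f x)"
      using assms(4) c fD(2)
      by (intro mult_left_mono Lp_norm_mono_const borel_measurable_continuous_onI) auto
    finally show ?thesis .
  qed
  then show ?thesis using \<gamma> c(1) by (intro exI[of _ "\<gamma> / c"]) simp
qed

end
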